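(* Let $(Z,d)$ be a finite ep-metric space, let $k \geq 1$ be an integer and let $S \geq 0$ be a real number. Let $R(k\text{-}N)$ and $V(k\text{-}N)$ be the ray complex and neighbourhood complex constructed from all $k$-bounded neighbourhoods of all points of $Z$. Suppose that $t \geq S$ is a real number. Then the function $$\pi_0 R_t(k\text{-}N) \to \pi_0 V_t(k\text{-}N)$$ induced by inclusion is a bijection.
   Context: An ep-metric space (extended pseudo-metric space) $(Z,d)$ is a set $Z$ with a function $d : Z\times Z \to [0,\infty]$ such that $d(x,x)=0$, $d(x,y)=d(y,x)$ and $d(x,z) \leq d(x,y)+d(y,z)$. Distinct points may have distance $0$, and distances may be infinite. With $k$ and $S$ fixed, a $k$-bounded neighbourhood of $x \in Z$ is a subset $N \subset Z(x,S) = \{y \in Z \mid d(x,y) \leq S\}$ with $x \in N$ and $|N| \leq k+1$. For a subset $M \subset Z$ and $t \geq 0$, $V_t(M)$ is the Vietoris-Rips complex: the abstract simplicial complex whose simplices are the non-empty finite subsets $\sigma \subset M$ with $d(u,v)\leq t$ for all $u,v\in\sigma$. The neighbourhood complex is $V_t(k\text{-}N) = \bigcup V_t(N) \subset V_t(Z)$, the union over all $k$-bounded neighbourhoods $N$ of all $x \in Z$. The ray complex $R_t(k\text{-}N) \subset V_t(k\text{-}N)$ is the graph with vertex set $Z$ and with an edge $\{x,y\}$, $x \neq y$, whenever $y$ belongs to some $k$-bounded neighbourhood of $x$ (or vice versa) and $d(x,y) \leq t$. $\pi_0$ denotes the set of path components. *)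

theory Defs
  imports "HOL-Analysis.Analysis"
begin

locale ep_metric_space =
  fixes Z :: "'a set" and d :: "'a \<Rightarrow> 'a \<Rightarrow> ennreal"
  assumes dist_refl: "x \<in> Z \<Longrightarrow> d x x = 0"
    and dist_sym: "\<lbrakk>x \<in> Z; y \<in> Z\<rbrakk> \<Longrightarrow> d x y = d y x"
    and dist_triangle: "\<lbrakk>x \<in> Z; y \<in> Z; z \<in> Z\<rbrakk> \<Longrightarrow> d x z \<le> d x y + d y z"

text \<open>Finiteness is part of the bound on the size of \<open>N\<close>, because \<^const>\<open>card\<close> is \<open>0\<close> on
  infinite sets.\<close>

definition bounded_nbhd :: "'a set \<Rightarrow> ('a \<Rightarrow> 'a \<Rightarrow> ennreal) \<Rightarrow> nat \<Rightarrow> real \<Rightarrow> 'a \<Rightarrow> 'a set \<Rightarrow> bool"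
  where "bounded_nbhd Z d k S x N \<longleftrightarrow>
    x \<in> Z \<and> N \<subseteq> {y \<in> Z. d x y \<le> ennreal S} \<and> x \<in> N \<and> finite N \<and> card N \<le> k + 1"

definition abstract_simplicial_complex :: "'a set set \<Rightarrow> bool"
  where "abstract_simplicial_complex K \<longleftrightarrow>
    (\<forall>\<sigma>\<in>K. finite \<sigma> \<and> \<sigma> \<noteq> {} \<and> (\<forall>\<tau>. \<tau> \<subseteq> \<sigma> \<and> \<tau> \<noteq> {} \<longrightarrow> \<tau> \<in> K))"

definition vietoris_rips :: "('a \<Rightarrow> 'a \<Rightarrow> ennreal) \<Rightarrow> real \<Rightarrow> 'a set \<Rightarrow> 'a set set"
  where "vietoris_rips d t M =
    {\<sigma>. finite \<sigma> \<and> \<sigma> \<noteq> {} \<and> \<sigma> \<subseteq> M \<and> (\<forall>u\<in>\<sigma>. \<forall>v\<in>\<sigma>. d u v \<le> ennreal t)}"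

definition nbhd_complex ::
    "'a set \<Rightarrow> ('a \<Rightarrow> 'a \<Rightarrow> ennreal) \<Rightarrow> nat \<Rightarrow> real \<Rightarrow> real \<Rightarrow> 'a set set"
  where "nbhd_complex Z d k S t =
    \<Union> {vietoris_rips d t N | N. \<exists>x\<in>Z. bounded_nbhd Z d k S x N}"

definition ray_complex ::
    "'a set \<Rightarrow> ('a \<Rightarrow> 'a \<Rightarrow> ennreal) \<Rightarrow> nat \<Rightarrow> real \<Rightarrow> real \<Rightarrow> 'a set set"
  where "ray_complex Z d k S t =
    {{x} | x. x \<in> Z} \<union>
    {{x, y} | x y. x \<in> Z \<and> y \<in> Z \<and> x \<noteq> y \<and> d x y \<le> ennreal t \<and>
        ((\<exists>N. bounded_nbhd Z d k S x N \<and> y \<in> N) \<or> (\<exists>N. bounded_nbhd Z d k S y N \<and> x \<in> N))}"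

text \<open>Points are given by their barycentric coordinates, extended by \<open>0\<close> to the whole type.
  A closed simplex carries the topology induced by the product topology on
  \<open>'a \<Rightarrow> real\<close>, which for a finite vertex set is the Euclidean one; the realization carries
  the weak topology with respect to its closed simplices.\<close>

definition closed_simplex :: "'a set \<Rightarrow> ('a \<Rightarrow> real) set"
  where "closed_simplex \<sigma> = {p. (\<forall>v. 0 \<le> p v) \<and> (\<forall>v. v \<notin> \<sigma> \<longrightarrow> p v = 0) \<and> sum p \<sigma> = 1}"

definition realization :: "'a set set \<Rightarrow> ('a \<Rightarrow> real) topology"
  where "realization K = topology (\<lambda>U. U \<subseteq> (\<Union>\<sigma>\<in>K. closed_simplex \<sigma>) \<and>
    (\<forall>\<sigma>\<in>K. openin (top_of_set (closed_simplex \<sigma>)) (U \<inter> closed_simplex \<sigma>)))"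

lemma openin_realization:
  "openin (realization K) U \<longleftrightarrow> U \<subseteq> (\<Union>\<sigma>\<in>K. closed_simplex \<sigma>) \<and>
    (\<forall>\<sigma>\<in>K. openin (top_of_set (closed_simplex \<sigma>)) (U \<inter> closed_simplex \<sigma>))"
proof -
  have "istopology (\<lambda>U. U \<subseteq> (\<Union>\<sigma>\<in>K. closed_simplex \<sigma>) \<and>
    (\<forall>\<sigma>\<in>K. openin (top_of_set (closed_simplex \<sigma>)) (U \<inter> closed_simplex \<sigma>)))"
    (is "istopology ?P")
    unfolding istopology_def
  proof (rule conjI; (rule allI impI)+)
    fix U V assume U: "?P U" and V: "?P V"
    have "openin (top_of_set C) (U \<inter> V \<inter> C)"
      if "openin (top_of_set C) (U \<inter> C)" "openin (top_of_set C) (V \<inter> C)" for C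
      using openin_Int[OF that] by (simp add: Int_ac)
    with U V show "?P (U \<inter> V)" by blast
  next
    fix \<U> assume \<U>: "\<forall>U\<in>\<U>. ?P U"
    have "openin (top_of_set C) (\<Union>\<U> \<inter> C)"
      if "\<forall>U\<in>\<U>. openin (top_of_set C) (U \<inter> C)" for C
      unfolding Int_Union2 using that by (intro openin_Union) auto
    with \<U> show "?P (\<Union>\<U>)" by blast
  qed
  then show ?thesis
    unfolding realization_def by (simp add: topology_inverse')
qed

lemma topspace_realization: "topspace (realization K) = (\<Union>\<sigma>\<in>K. closed_simplex \<sigma>)"
proof (rule antisym)
  show "topspace (realization K) \<subseteq> (\<Union>\<sigma>\<in>K. closed_simplex \<sigma>)"
    using openin_topspace[of "realization K"] unfolding openin_realization by blast
  have "(\<Union>\<sigma>\<in>K. closed_simplex \<sigma>) \<inter> closed_simplex \<tau> = closed_simplex \<tau>" if "\<tau> \<in> K" for \<tau> :: "'a set"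
    using that by auto
  then have "openin (realization K) (\<Union>\<sigma>\<in>K. closed_simplex \<sigma>)"
    unfolding openin_realization by auto
  then show "(\<Union>\<sigma>\<in>K. closed_simplex \<sigma>) \<subseteq> topspace (realization K)"
    by (rule openin_subset)
qed

lemma continuous_map_realization_mono:
  assumes "K \<subseteq> L"
  shows "continuous_map (realization K) (realization L) id"
proof -
  have "openin (realization K) {x \<in> topspace (realization K). id x \<in> U}"
    if U: "openin (realization L) U" for U
  proof -
    have "{x \<in> topspace (realization K). id x \<in> U} \<inter> closed_simplex \<sigma> = U \<inter> closed_simplex \<sigma>"
      if "\<sigma> \<in> K" for \<sigma>
      using that by (auto simp: topspace_realization)
    with U assms show ?thesis
      unfolding openin_realization by (auto simp: topspace_realization)
  qed
  with assms show ?thesis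
    unfolding continuous_map_def by (auto simp: topspace_realization)
qed

abbreviation pi0 :: "'a set set \<Rightarrow> ('a \<Rightarrow> real) set set"
  where "pi0 K \<equiv> path_components_of (realization K)"

text \<open>If \<open>f\<close> is continuous from \<open>X\<close> to \<open>Y\<close>, then exactly one path component of \<open>Y\<close> contains
  the image of a path component of \<open>X\<close>.\<close>

definition pi0_map :: "'a topology \<Rightarrow> 'b topology \<Rightarrow> ('a \<Rightarrow> 'b) \<Rightarrow> 'a set \<Rightarrow> 'b set"
  where "pi0_map X Y f C = (THE D. D \<in> path_components_of Y \<and> f ` C \<subseteq> D)"

lemma pi0_map_path_component_of:
  assumes f: "continuous_map X Y f" and x: "x \<in> topspace X"
  shows "pi0_map X Y f (path_component_of_set X x) = path_component_of_set Y (f x)"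
  unfolding pi0_map_def
proof (rule the_equality, intro conjI)
  have fx: "f x \<in> topspace Y"
    using f x by (auto simp: continuous_map_def)
  then show "path_component_of_set Y (f x) \<in> path_components_of Y"
    unfolding path_components_of_def by blast
  show "f ` path_component_of_set X x \<subseteq> path_component_of_set Y (f x)"
    using pathin_compose[OF _ f] unfolding path_component_of_def by fastforce
  fix D assume D: "D \<in> path_components_of Y \<and> f ` path_component_of_set X x \<subseteq> D"
  have "f x \<in> D"
    using D x by (auto simp: path_component_of_refl)
  moreover from D obtain y where y: "D = path_component_of_set Y y"
    unfolding path_components_of_def by blast
  ultimately have "path_component_of Y y (f x)" by simp
  with y show "D = path_component_of_set Y (f x)"
    using path_component_of_equiv[of Y y "f x"] by simp
qed

lemma abstract_simplicial_complex_nbhd: "abstract_simplicial_complex (nbhd_complex Z d k S t)"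
  unfolding abstract_simplicial_complex_def
proof (intro ballI)
  fix \<sigma> assume "\<sigma> \<in> nbhd_complex Z d k S t"
  then obtain N x where N: "x \<in> Z" "bounded_nbhd Z d k S x N" "\<sigma> \<in> vietoris_rips d t N"
    unfolding nbhd_complex_def by auto
  have "\<tau> \<in> vietoris_rips d t N" if "\<tau> \<subseteq> \<sigma>" "\<tau> \<noteq> {}" for \<tau>
    using N(3) that finite_subset[of \<tau> \<sigma>] unfolding vietoris_rips_def by blast
  with N show "finite \<sigma> \<and> \<sigma> \<noteq> {} \<and>
      (\<forall>\<tau>. \<tau> \<subseteq> \<sigma> \<and> \<tau> \<noteq> {} \<longrightarrow> \<tau> \<in> nbhd_complex Z d k S t)"
    unfolding nbhd_complex_def vietoris_rips_def by blast
qed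

lemma abstract_simplicial_complex_ray: "abstract_simplicial_complex (ray_complex Z d k S t)"
  unfolding abstract_simplicial_complex_def
proof (intro ballI)
  fix \<sigma> assume \<sigma>: "\<sigma> \<in> ray_complex Z d k S t"
  then obtain x y where xy: "x \<in> Z" "y \<in> Z" "\<sigma> = {x, y}"
    unfolding ray_complex_def by auto
  have "\<tau> \<in> ray_complex Z d k S t" if "\<tau> \<subseteq> \<sigma>" "\<tau> \<noteq> {}" for \<tau>
  proof -
    have "\<tau> = {x} \<or> \<tau> = {y} \<or> \<tau> = \<sigma>"
      using that xy(3) by blast
    then show ?thesis
      using \<sigma> xy(1,2) unfolding ray_complex_def by blast
  qed
  with xy show "finite \<sigma> \<and> \<sigma> \<noteq> {} \<and>
      (\<forall>\<tau>. \<tau> \<subseteq> \<sigma> \<and> \<tau> \<noteq> {} \<longrightarrow> \<tau> \<in> ray_complex Z d k S t)"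
    by auto
qed

lemma (in ep_metric_space) ray_complex_subset_nbhd_complex:
  "ray_complex Z d k S t \<subseteq> nbhd_complex Z d k S t"
proof
  fix \<sigma> assume "\<sigma> \<in> ray_complex Z d k S t"
  then consider x where "x \<in> Z" "\<sigma> = {x}"
    | x y N where "x \<in> Z" "y \<in> Z" "\<sigma> = {x, y}" "d x y \<le> ennreal t"
        "bounded_nbhd Z d k S x N" "y \<in> N"
    | x y N where "x \<in> Z" "y \<in> Z" "\<sigma> = {x, y}" "d x y \<le> ennreal t"
        "bounded_nbhd Z d k S y N" "x \<in> N"
    unfolding ray_complex_def by auto
  then show "\<sigma> \<in> nbhd_complex Z d k S t"
  proof cases
    case 1
    then have "bounded_nbhd Z d k S x {x}" "\<sigma> \<in> vietoris_rips d t {x}"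
      by (auto simp: bounded_nbhd_def vietoris_rips_def dist_refl)
    with 1 show ?thesis unfolding nbhd_complex_def by blast
  next
    case 2
    then have "\<sigma> \<in> vietoris_rips d t N"
      by (auto simp: bounded_nbhd_def vietoris_rips_def dist_refl dist_sym)
    with 2 show ?thesis unfolding nbhd_complex_def by blast
  next
    case 3
    then have "\<sigma> \<in> vietoris_rips d t N"
      by (auto simp: bounded_nbhd_def vietoris_rips_def dist_refl dist_sym)
    with 3 show ?thesis unfolding nbhd_complex_def by blast
  qed
qed

end

theory Submission
  imports Defs
begin

text \<open>Path components of a realization are a matter of the 1-skeleton: every point is joined to a
  vertex inside a closed simplex, and two vertices lie in the same path component exactly when an
  edge path joins them (\<open>path_component_of_vertices_iff\<close>). So an inclusion of complexes with
  the same vertices induces a bijection on path components as soon as the end points of every edge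
  of the larger complex are joined by an edge path in the smaller one
  (\<open>bij_betw_pi0_map_subcomplex\<close>).

  In the situation of the theorem, an edge of the neighbourhood complex has both end points
  \<open>u\<close>, \<open>v\<close> in a bounded neighbourhood of some centre \<open>x\<close>. The distances from \<open>x\<close> to \<open>u\<close> and \<open>v\<close>
  are at most \<open>S \<le> t\<close>, so the rays from \<open>x\<close> give the edge path \<open>u\<close>, \<open>x\<close>, \<open>v\<close> in the ray
  complex.\<close>

definition edge_connected :: "'a set set \<Rightarrow> 'a \<Rightarrow> 'a \<Rightarrow> bool"
  where "edge_connected K = (\<lambda>u v. {u, v} \<in> K)\<^sup>*\<^sup>*"

text \<open>The barycentric coordinates of a vertex.\<close>

abbreviation vertex :: "'a \<Rightarrow> 'a \<Rightarrow> real"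
  where "vertex v \<equiv> indicator {v}"

lemma vertex_in_closed_simplex_iff:
  assumes "finite \<sigma>"
  shows "vertex v \<in> closed_simplex \<sigma> \<longleftrightarrow> v \<in> \<sigma>"
  using assms by (auto simp: closed_simplex_def indicator_def)

lemma closed_simplices_meet_imp_common_vertex:
  assumes "p \<in> closed_simplex \<sigma>" "p \<in> closed_simplex \<tau>"
  obtains v where "v \<in> \<sigma>" "v \<in> \<tau>"
proof -
  have "sum p \<sigma> \<noteq> 0"
    using assms(1) by (simp add: closed_simplex_def)
  then obtain v where "v \<in> \<sigma>" "p v \<noteq> 0"
    by (metis sum.neutral)
  with assms(2) that show thesis
    unfolding closed_simplex_def by blast
qed

text \<open>A closed simplex is convex, and the straight segment between two of its points is continuous
  for the weak topology because every set that is open in the weak topology meets the simplex in a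
  relatively open set of the product topology.\<close>

lemma path_component_of_closed_simplex:
  assumes \<sigma>: "\<sigma> \<in> K" and p: "p \<in> closed_simplex \<sigma>" and q: "q \<in> closed_simplex \<sigma>"
  shows "path_component_of (realization K) p q"
proof -
  let ?C = "closed_simplex \<sigma>"
  define g where "g = (\<lambda>s::real. \<lambda>v. (1 - s) * p v + s * q v)"
  have "g s \<in> ?C" if s: "s \<in> {0..1}" for s
  proof -
    have "sum (g s) \<sigma> = (1 - s) * sum p \<sigma> + s * sum q \<sigma>"
      unfolding g_def by (simp add: sum.distrib sum_distrib_left)
    with s p q show ?thesis
      by (auto simp: closed_simplex_def g_def)
  qed
  moreover have "continuous_on {0..1} g"
    unfolding g_def by (intro continuous_on_coordinatewise_then_product continuous_intros)
  ultimately have g: "continuous_map (top_of_set {0..1}) (top_of_set ?C) g"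
    by auto
  have "openin (top_of_set ?C) {x \<in> ?C. x \<in> U}" if "openin (realization K) U" for U
    using that \<sigma> unfolding openin_realization by (auto simp: Int_def conj_commute)
  then have "continuous_map (top_of_set ?C) (realization K) id"
    using \<sigma> by (auto simp: continuous_map_def topspace_realization)
  from continuous_map_compose[OF g this] have "pathin (realization K) g"
    by (simp add: pathin_def)
  moreover have "g 0 = p" "g 1 = q"
    by (auto simp: g_def)
  ultimately show ?thesis
    unfolding path_component_of_def by blast
qed

lemma edge_connected_imp_path_component_of:
  assumes K: "abstract_simplicial_complex K" and uv: "edge_connected K u v" and u: "u \<in> \<Union>K"
  shows "path_component_of (realization K) (vertex u) (vertex v)"
  using uv unfolding edge_connected_def
proof (induction rule: rtranclp_induct)
  case base
  from u obtain \<sigma> where "\<sigma> \<in> K" "u \<in> \<sigma>" by blast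
  with K have "vertex u \<in> closed_simplex \<sigma>"
    by (simp add: vertex_in_closed_simplex_iff abstract_simplicial_complex_def)
  with \<open>\<sigma> \<in> K\<close> show ?case
    by (intro path_component_of_closed_simplex)
next
  case (step v w)
  have "vertex v \<in> closed_simplex {v, w}" "vertex w \<in> closed_simplex {v, w}"
    by (auto simp: vertex_in_closed_simplex_iff)
  with step.hyps have "path_component_of (realization K) (vertex v) (vertex w)"
    by (intro path_component_of_closed_simplex)
  with step.IH show ?case
    by (rule path_component_of_trans)
qed

text \<open>The simplices spanned by an edge-connectivity class of vertices form a part of the
  realization that is both open and closed: a closed simplex that meets it shares a vertex with
  the class, so all of its vertices belong to the class. A path cannot leave such a part.\<close>

lemma path_component_of_imp_edge_connected:
  assumes K: "abstract_simplicial_complex K" and u: "u \<in> \<Union>K"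
    and uv: "path_component_of (realization K) (vertex u) (vertex v)"
  shows "edge_connected K u v"
proof -
  let ?X = "realization K"
  define A where "A = {w. edge_connected K u w}"
  define T where "T = (\<Union>\<sigma>\<in>{\<sigma>\<in>K. \<sigma> \<subseteq> A}. closed_simplex \<sigma>)"
  have fin: "finite \<sigma>" if "\<sigma> \<in> K" for \<sigma>
    using K that by (simp add: abstract_simplicial_complex_def)
  have absorb: "\<sigma> \<subseteq> A" if "\<sigma> \<in> K" "w \<in> \<sigma>" "w \<in> A" for \<sigma> w
  proof
    fix y assume "y \<in> \<sigma>"
    with that(2) have "{w, y} \<subseteq> \<sigma>" "{w, y} \<noteq> {}" by auto
    with K that(1) have "{w, y} \<in> K"
      unfolding abstract_simplicial_complex_def by metis
    then show "y \<in> A"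
      using that(3) rtranclp.rtrancl_into_rtrancl[of "\<lambda>u v. {u, v} \<in> K" u w y]
      unfolding A_def edge_connected_def by simp
  qed
  have inter: "T \<inter> closed_simplex \<tau> = (if \<tau> \<subseteq> A then closed_simplex \<tau> else {})" if "\<tau> \<in> K" for \<tau>
  proof (cases "\<tau> \<subseteq> A")
    case True
    with that show ?thesis unfolding T_def by auto
  next
    case False
    have "p \<notin> closed_simplex \<tau>" if "p \<in> closed_simplex \<sigma>" "\<sigma> \<subseteq> A" for p \<sigma>
      using that False absorb[OF \<open>\<tau> \<in> K\<close>] closed_simplices_meet_imp_common_vertex by blast
    with False show ?thesis unfolding T_def by auto
  qed
  have sub: "T \<subseteq> topspace ?X"
    unfolding T_def topspace_realization by blast
  have "openin ?X T"
    using sub inter unfolding openin_realization topspace_realization by auto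
  moreover have "openin ?X (topspace ?X - T)"
  proof -
    have "(topspace ?X - T) \<inter> closed_simplex \<tau> = (if \<tau> \<subseteq> A then {} else closed_simplex \<tau>)"
      if "\<tau> \<in> K" for \<tau>
      using inter[OF that] that unfolding topspace_realization by (auto split: if_splits)
    then show ?thesis
      unfolding openin_realization by (auto simp: topspace_realization)
  qed
  ultimately have clopen: "openin ?X T" "closedin ?X T"
    using sub by (auto simp: closedin_def)
  have "connectedin ?X (path_component_of_set ?X (vertex u))"
    by (intro path_connectedin_imp_connectedin path_connectedin_path_component_of)
  then consider "path_component_of_set ?X (vertex u) \<subseteq> T"
    | "disjnt (path_component_of_set ?X (vertex u)) T"
    using connectedin_clopen_cases clopen by metis
  moreover have "vertex u \<in> T"
  proof -
    from u obtain \<sigma> where \<sigma>: "\<sigma> \<in> K" "u \<in> \<sigma>" by blast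
    then have "\<sigma> \<subseteq> A"
      using absorb by (auto simp: A_def edge_connected_def)
    moreover have "vertex u \<in> closed_simplex \<sigma>"
      using \<sigma> fin by (simp add: vertex_in_closed_simplex_iff)
    ultimately show ?thesis
      using \<sigma>(1) unfolding T_def by blast
  qed
  moreover have "vertex u \<in> path_component_of_set ?X (vertex u)"
    using \<open>vertex u \<in> T\<close> sub by (auto simp: path_component_of_refl)
  ultimately have "vertex v \<in> T"
    using uv by (auto simp: disjnt_def)
  then obtain \<sigma> where \<sigma>: "\<sigma> \<in> K" "\<sigma> \<subseteq> A" "vertex v \<in> closed_simplex \<sigma>"
    unfolding T_def by blast
  with fin have "v \<in> \<sigma>"
    by (simp add: vertex_in_closed_simplex_iff)
  with \<sigma>(2) show ?thesis
    unfolding A_def by blast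
qed

lemma path_component_of_vertices_iff:
  assumes "abstract_simplicial_complex K" "u \<in> \<Union>K"
  shows "path_component_of (realization K) (vertex u) (vertex v) \<longleftrightarrow> edge_connected K u v"
  using edge_connected_imp_path_component_of[OF assms(1) _ assms(2)]
    path_component_of_imp_edge_connected[OF assms] by (rule iffI[rotated])

lemma path_component_contains_vertex:
  assumes K: "abstract_simplicial_complex K" and C: "C \<in> pi0 K"
  obtains u where "u \<in> \<Union>K" "C = path_component_of_set (realization K) (vertex u)"
    "vertex u \<in> topspace (realization K)"
proof -
  from C obtain p where p: "p \<in> topspace (realization K)"
      "C = path_component_of_set (realization K) p"
    unfolding path_components_of_def by blast
  then obtain \<sigma> where \<sigma>: "\<sigma> \<in> K" "p \<in> closed_simplex \<sigma>"
    unfolding topspace_realization by blast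
  with K obtain u where u: "u \<in> \<sigma>" "finite \<sigma>"
    unfolding abstract_simplicial_complex_def by blast
  then have v: "vertex u \<in> closed_simplex \<sigma>"
    by (simp add: vertex_in_closed_simplex_iff)
  with \<sigma> have "path_component_of (realization K) p (vertex u)"
    by (intro path_component_of_closed_simplex)
  then have "C = path_component_of_set (realization K) (vertex u)"
    using p(2) path_component_of_equiv by metis
  with \<sigma>(1) u(1) v that show thesis
    unfolding topspace_realization by blast
qed

lemma bij_betw_pi0_map_subcomplex:
  assumes K: "abstract_simplicial_complex K" and L: "abstract_simplicial_complex L"
    and "K \<subseteq> L" and vertices: "\<Union>L \<subseteq> \<Union>K"
    and edges: "\<And>u v. {u, v} \<in> L \<Longrightarrow> edge_connected K u v"
  shows "bij_betw (pi0_map (realization K) (realization L) id) (pi0 K) (pi0 L)"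
proof -
  let ?X = "realization K" and ?Y = "realization L"
  let ?f = "pi0_map ?X ?Y id"
  have edge_connected_L: "edge_connected K u v" if "edge_connected L u v" for u v
    using that unfolding edge_connected_def
  proof (induction rule: rtranclp_induct)
    case (step v w)
    with edges[of v w] show ?case
      unfolding edge_connected_def by (blast intro: rtranclp_trans)
  qed simp
  have f: "?f (path_component_of_set ?X p) = path_component_of_set ?Y p" if "p \<in> topspace ?X" for p
    using pi0_map_path_component_of[OF continuous_map_realization_mono[OF \<open>K \<subseteq> L\<close>] that] by simp
  have top: "topspace ?X \<subseteq> topspace ?Y"
    using \<open>K \<subseteq> L\<close> unfolding topspace_realization by blast
  have "inj_on ?f (pi0 K)"
  proof (rule inj_onI)
    fix C D assume CD: "C \<in> pi0 K" "D \<in> pi0 K" and eq: "?f C = ?f D"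
    from K CD(1) obtain u where u: "u \<in> \<Union>K" "C = path_component_of_set ?X (vertex u)"
        "vertex u \<in> topspace ?X"
      by (rule path_component_contains_vertex)
    from K CD(2) obtain v where v: "v \<in> \<Union>K" "D = path_component_of_set ?X (vertex v)"
        "vertex v \<in> topspace ?X"
      by (rule path_component_contains_vertex)
    have "path_component_of_set ?Y (vertex u) = path_component_of_set ?Y (vertex v)"
      using eq f u v by simp
    moreover have "path_component_of ?Y (vertex v) (vertex v)"
      using v(3) top by (auto simp: path_component_of_refl)
    ultimately have "path_component_of ?Y (vertex u) (vertex v)"
      by (metis mem_Collect_eq)
    moreover have "u \<in> \<Union>L"
      using u(1) \<open>K \<subseteq> L\<close> by blast
    ultimately have "edge_connected L u v"
      by (simp add: path_component_of_vertices_iff[OF L])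
    then have "edge_connected K u v"
      by (rule edge_connected_L)
    then have "path_component_of ?X (vertex u) (vertex v)"
      by (simp add: path_component_of_vertices_iff[OF K u(1)])
    then show "C = D"
      using u(2) v(2) path_component_of_equiv by metis
  qed
  moreover have "?f ` pi0 K = pi0 L"
  proof (rule antisym)
    show "?f ` pi0 K \<subseteq> pi0 L"
      using f top unfolding path_components_of_def by auto
    show "pi0 L \<subseteq> ?f ` pi0 K"
    proof
      fix D assume "D \<in> pi0 L"
      with L obtain u where u: "u \<in> \<Union>L" "D = path_component_of_set ?Y (vertex u)"
        by (rule path_component_contains_vertex)
      from u(1) vertices obtain \<sigma> where \<sigma>: "\<sigma> \<in> K" "u \<in> \<sigma>" by blast
      with K have "vertex u \<in> closed_simplex \<sigma>"
        by (simp add: vertex_in_closed_simplex_iff abstract_simplicial_complex_def)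
      with \<sigma>(1) have "vertex u \<in> topspace ?X"
        unfolding topspace_realization by blast
      with f[OF this] u(2) show "D \<in> ?f ` pi0 K"
        unfolding path_components_of_def by auto
    qed
  qed
  ultimately show ?thesis
    by (simp add: bij_betw_def)
qed

lemma ray_complex_edge_to_centre:
  assumes N: "bounded_nbhd Z d k S x N" and "u \<in> N" and "S \<le> t"
  shows "{x, u} \<in> ray_complex Z d k S t"
proof -
  have "x \<in> Z" "u \<in> Z" "d x u \<le> ennreal S"
    using N \<open>u \<in> N\<close> by (auto simp: bounded_nbhd_def)
  moreover from this \<open>S \<le> t\<close> have "d x u \<le> ennreal t"
    by (meson ennreal_leI order_trans)
  ultimately show ?thesis
    using N \<open>u \<in> N\<close> unfolding ray_complex_def by (cases "x = u") auto
qed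

theorem lemma16:
  fixes Z :: "'a set" and d :: "'a \<Rightarrow> 'a \<Rightarrow> ennreal" and k :: nat and S t :: real
  assumes "ep_metric_space Z d"
    and "finite Z"
    and "k \<ge> 1"
    and "S \<ge> 0"
    and "t \<ge> S"
  shows "bij_betw
    (pi0_map (realization (ray_complex Z d k S t)) (realization (nbhd_complex Z d k S t)) id)
    (pi0 (ray_complex Z d k S t)) (pi0 (nbhd_complex Z d k S t))"
proof (rule bij_betw_pi0_map_subcomplex)
  let ?R = "ray_complex Z d k S t" and ?V = "nbhd_complex Z d k S t"
  show "abstract_simplicial_complex ?R" "abstract_simplicial_complex ?V"
    by (rule abstract_simplicial_complex_ray abstract_simplicial_complex_nbhd)+
  show "?R \<subseteq> ?V"
    using assms(1) by (rule ep_metric_space.ray_complex_subset_nbhd_complex)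
  have "\<Union>?V \<subseteq> Z"
    unfolding nbhd_complex_def vietoris_rips_def bounded_nbhd_def by blast
  also have "Z \<subseteq> \<Union>?R"
    unfolding ray_complex_def by blast
  finally show "\<Union>?V \<subseteq> \<Union>?R" .
  fix u v assume "{u, v} \<in> ?V"
  then obtain x N where "bounded_nbhd Z d k S x N" "u \<in> N" "v \<in> N"
    unfolding nbhd_complex_def vietoris_rips_def by blast
  with \<open>t \<ge> S\<close> have "{u, x} \<in> ?R" "{x, v} \<in> ?R"
    using ray_complex_edge_to_centre[of Z d k S x N] by (simp_all add: insert_commute)
  then show "edge_connected ?R u v"
    unfolding edge_connected_def by (meson converse_rtranclp_into_rtranclp r_into_rtranclp)
qed

end
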